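(* For every $\varepsilon>0$ and every integer $p\ge 2$, any (possibly randomized) $p$-player protocol for Max-Card-$k$ (in the $p$-player model described in the context) with an approximation guarantee of $$\frac{p+(H_p)^2}{2p-H_p}\cdot(1+\varepsilon)$$ must have communication complexity $\Omega\!\left(\frac{N\varepsilon}{p^3}\right)$, where $N=|W|$. Furthermore, this holds even in the special case in which the objective function $f$ is a (weighted) coverage function and $k=p$.
   Context: $H_p=1+\frac12+\cdots+\frac1p$ is the $p$-th harmonic number. The $p$-player model for Max-Card-$k$: the global information known to all players is a positive integer $k$, a finite ground set $W$ and a partition of $W$ into disjoint sets $W_1,\dots,W_p$. Player $i\in[p]$ privately receives a set $V_i\subseteq W_i$ and a value oracle for a non-negative monotone submodular function $f:2^W\to\mathbb{R}_{\ge0}$ that can evaluate $f$ on every subset of $W_1\cup\cdots\cup W_i$. A protocol consists of $p$ possibly randomized algorithms: player 1 computes a message $m_1$ from the global information and its private information; for $i=2,\dots,p-1$, player $i$ computes $m_i$ from the global information, its private information and $m_{i-1}$; player $p$ computes from the global information, its private information and $m_{p-1}$ an output $S\subseteq V_1\cup\cdots\cup V_p$ with $|S|\le k$. The communication complexity is the maximum length in bits of any of $m_1,\dots,m_{p-1}$ over all inputs and randomness. The approximation guarantee is $\rho$ if for every instance $\mathbb{E}[f(S)]\ge\rho\cdot\max\{f(T):T\subseteq V_1\cup\cdots\cup V_p,\ |T|\le k\}$. A weighted coverage function is $f(S)=\sum_{u\in\bigcup_{v\in S}v} a(u)$ where each element of $W$ is a subset of a finite universe $U$ with weights $a:U\to\mathbb{R}_{\ge0}$.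 The constant in $\Omega$ is absolute. *)

theory Defs
  imports "HOL-Analysis.Analysis" "HOL-Probability.Probability"
begin

definition cov :: "('u \<Rightarrow> real) \<Rightarrow> 'u set set \<Rightarrow> real" where
  "cov a S = (\<Sum>u\<in>\<Union>S. a u)"

definition is_partition :: "'e set \<Rightarrow> nat \<Rightarrow> (nat \<Rightarrow> 'e set) \<Rightarrow> bool" where
  "is_partition W p Wp \<longleftrightarrow> disjoint_family_on Wp {1..p} \<and> (\<Union>i\<in>{1..p}. Wp i) = W"

text \<open>Value-oracle of player i: f restricted to subsets of W_1 u ... u W_i
(value 0 on all other sets, which carries no information).\<close>
definition val_access :: "(nat \<Rightarrow> 'e set) \<Rightarrow> nat \<Rightarrow> ('e set \<Rightarrow> real) \<Rightarrow> ('e set \<Rightarrow> real)" where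
  "val_access Wp i f = (\<lambda>S. if S \<subseteq> (\<Union>j\<in>{1..i}. Wp j) then f S else 0)"

text \<open>Distribution of message m_i (m_0 = [] is the empty message given to player 1).
A i V_i Orc_i m_{i-1} is the randomized (private-coin) algorithm of player i < p,
Orc_i being its val_access.\<close>
fun msgs :: "(nat \<Rightarrow> 'e set \<Rightarrow> ('e set \<Rightarrow> real) \<Rightarrow> bool list \<Rightarrow> bool list pmf)
    \<Rightarrow> (nat \<Rightarrow> 'e set) \<Rightarrow> (nat \<Rightarrow> 'e set \<Rightarrow> real) \<Rightarrow> nat \<Rightarrow> bool list pmf" where
  "msgs A V Orc 0 = return_pmf []"
| "msgs A V Orc (Suc i) = bind_pmf (msgs A V Orc i) (A (Suc i) (V (Suc i)) (Orc (Suc i)))"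

definition prot_output :: "(nat \<Rightarrow> 'e set \<Rightarrow> ('e set \<Rightarrow> real) \<Rightarrow> bool list \<Rightarrow> bool list pmf)
    \<Rightarrow> ('e set \<Rightarrow> ('e set \<Rightarrow> real) \<Rightarrow> bool list \<Rightarrow> 'e set pmf)
    \<Rightarrow> nat \<Rightarrow> (nat \<Rightarrow> 'e set) \<Rightarrow> (nat \<Rightarrow> 'e set \<Rightarrow> real) \<Rightarrow> 'e set pmf" where
  "prot_output A Out p V Orc = bind_pmf (msgs A V Orc (p - 1)) (Out (V p) (Orc p))"

definition cov_input :: "nat \<Rightarrow> (nat \<Rightarrow> 'u set set) \<Rightarrow> (nat \<Rightarrow> 'u set set) \<Rightarrow> ('u \<Rightarrow> real) \<Rightarrow> bool" where
  "cov_input p Wp V a \<longleftrightarrow> (\<forall>i\<in>{1..p}. V i \<subseteq> Wp i) \<and> (\<forall>u. 0 \<le> a u)"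

definition cov_protocol_guarantee ::
  "nat \<Rightarrow> nat \<Rightarrow> (nat \<Rightarrow> 'u set set) \<Rightarrow> real
   \<Rightarrow> (nat \<Rightarrow> 'u set set \<Rightarrow> ('u set set \<Rightarrow> real) \<Rightarrow> bool list \<Rightarrow> bool list pmf)
   \<Rightarrow> ('u set set \<Rightarrow> ('u set set \<Rightarrow> real) \<Rightarrow> bool list \<Rightarrow> 'u set set pmf) \<Rightarrow> bool" where
  "cov_protocol_guarantee k p Wp \<rho> A Out \<longleftrightarrow>
     (\<forall>V a. cov_input p Wp V a \<longrightarrow>
        (let Orc = (\<lambda>i. val_access Wp i (cov a));
             S = prot_output A Out p V Orc;
             VV = (\<Union>i\<in>{1..p}. V i)
         in (\<forall>T\<in>set_pmf S. T \<subseteq> VV \<and> card T \<le> k) \<and>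
            measure_pmf.expectation S (cov a) \<ge>
              \<rho> * Max {cov a T | T. T \<subseteq> VV \<and> card T \<le> k}))"

text \<open>Lengths of all messages m_1..m_{p-1} over all (coverage) inputs and randomness;
the communication complexity is the supremum of this set.\<close>
definition cov_msg_lengths ::
  "nat \<Rightarrow> (nat \<Rightarrow> 'u set set)
   \<Rightarrow> (nat \<Rightarrow> 'u set set \<Rightarrow> ('u set set \<Rightarrow> real) \<Rightarrow> bool list \<Rightarrow> bool list pmf) \<Rightarrow> nat set" where
  "cov_msg_lengths p Wp A =
     {length m | m V a i. cov_input p Wp V a \<and> i \<in> {1..p - 1} \<and>
        m \<in> set_pmf (msgs A V (\<lambda>j. val_access Wp j (cov a)) i)}"

end

theory Submission
  imports Defs "HOL-Library.Nat_Bijection"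
begin

text \<open>
  Every class \<open>i\<close> of the ground set has one special element \<open>t i\<close>. The specials cover disjoint regions
  \<open>R 1, \<dots>, R p\<close> of total mass \<open>1\<close>, where the regions after the \<open>l\<close>-th have mass
  \<open>B l = sqrt ((p - l) / p)\<close>; a non-special element of class \<open>i\<close> covers an independent random
  fraction \<open>1 - B i / B (i - 1)\<close> of \<open>R i, \<dots>, R p\<close>. On the first \<open>i\<close> classes this function does not
  reveal which element of class \<open>i\<close> is special. Without specials, \<open>p\<close> elements are worth at most
  \<open>1/2 + O((log p)^2 / p)\<close>: the uncovered mass is convex in the numbers of elements taken from
  the classes, and for this choice of \<open>B\<close> its tangent at "one from each class" is almost
  constant over the classes.

  Hence a protocol beating the ratio by a factor \<open>1 + \<epsilon>\<close> outputs a special of some class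
  \<open>i < p\<close> with probability at least \<open>\<epsilon>/2\<close>. Player \<open>i\<close> owns one element of each of \<open>s\<close> pairs,
  and the special is a uniformly random owned element, chosen independently of the message. As
  outputs must consist of owned elements, the special can only be output if all choices compatible
  with the message agree on its pair. A message of \<open>L\<close> bits fixes at most \<open>L + 2\<close> pairs on average,
  so \<open>\<epsilon>/2 \<le> (p - 1) (L + 2) / s\<close>, with \<open>s\<close> about \<open>N / (2 p)\<close>.
\<close>

section \<open>Value of solutions without special elements\<close>

text \<open>\<open>tail_mass p l\<close> is the \<open>B l\<close> of the overview,
  \<open>opt_mass p l\<close> the mass of the region \<open>R l\<close>, and
  \<open>shrink p l\<close> the fraction that one non-special element of class \<open>l\<close>
  leaves uncovered.\<close>

definition tail_mass :: "nat \<Rightarrow> nat \<Rightarrow> real" where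
  "tail_mass p l = sqrt (real (p - l) / real p)"

definition opt_mass :: "nat \<Rightarrow> nat \<Rightarrow> real" where
  "opt_mass p l = tail_mass p (l - 1) - tail_mass p l"

definition shrink :: "nat \<Rightarrow> nat \<Rightarrow> real" where
  "shrink p l = tail_mass p l / tail_mass p (l - 1)"

lemma tail_mass_nonneg: "0 \<le> tail_mass p l"
  by (simp add: tail_mass_def)

lemma tail_mass_pos: "l < p \<Longrightarrow> 0 < tail_mass p l"
  by (simp add: tail_mass_def)

lemma tail_mass_0: "0 < p \<Longrightarrow> tail_mass p 0 = 1"
  by (simp add: tail_mass_def)

lemma tail_mass_self: "tail_mass p p = 0"
  by (simp add: tail_mass_def)

lemma tail_mass_antimono: "l \<le> l' \<Longrightarrow> tail_mass p l' \<le> tail_mass p l"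
  by (auto simp: tail_mass_def intro!: divide_right_mono)

lemma opt_mass_nonneg: "0 \<le> opt_mass p l"
  by (simp add: opt_mass_def tail_mass_antimono)

lemma shrink_nonneg: "0 \<le> shrink p l"
  by (simp add: shrink_def tail_mass_nonneg)

lemma shrink_le_1: "shrink p l \<le> 1"
proof -
  have "tail_mass p l \<le> tail_mass p (l - 1)" by (simp add: tail_mass_antimono)
  thus ?thesis using tail_mass_nonneg[of p "l - 1"] tail_mass_nonneg[of p l]
    by (auto simp: shrink_def divide_le_eq_1)
qed

lemma shrink_pos: "1 \<le> l \<Longrightarrow> l < p \<Longrightarrow> 0 < shrink p l"
  by (simp add: shrink_def tail_mass_pos)

lemma shrink_self: "shrink p p = 0"
  by (simp add: shrink_def tail_mass_self)

lemma sum_opt_mass: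
  assumes "1 \<le> i" "i \<le> Suc p"
  shows "(\<Sum>l\<in>{i..p}. opt_mass p l) = tail_mass p (i - 1)"
  using assms(2,1)
proof (induction i rule: inc_induct)
  case base
  then show ?case by (simp add: tail_mass_self)
next
  case (step n)
  then show ?case
    by (subst sum.atLeast_Suc_atMost) (auto simp: opt_mass_def)
qed

text \<open>The squares of \<open>tail_mass\<close> fall by exactly \<open>1/p\<close> per step, and
  \<open>2 (x - y) y <= x^2 - y^2\<close>.\<close>

lemma opt_mass_tail_mass_le:
  assumes "1 \<le> l" "l \<le> p"
  shows "opt_mass p l * tail_mass p l \<le> 1 / (2 * real p)"
proof -
  define x y where "x = tail_mass p (l - 1)" and "y = tail_mass p l"
  have "0 \<le> (x - y)\<^sup>2" by simp
  hence "2 * ((x - y) * y) \<le> x\<^sup>2 - y\<^sup>2"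
    by (simp add: power2_eq_square algebra_simps)
  also have "\<dots> = 1 / real p"
    using assms by (simp add: x_def y_def tail_mass_def of_nat_diff field_simps)
  finally show ?thesis by (simp add: opt_mass_def x_def y_def field_simps)
qed

lemma opt_mass_tail_mass_ge:
  assumes "1 \<le> l" "l < p"
  shows "(1 / 2 - 1 / (8 * real (p - l))) / real p \<le> opt_mass p l * tail_mass p l"
proof -
  define m where "m = real (p - l)"
  have m: "1 \<le> m" using assms by (simp add: m_def)
  have m1: "real (p - (l - 1)) = m + 1" using assms by (simp add: m_def of_nat_diff)
  have t1: "tail_mass p (l - 1) = sqrt (m + 1) / sqrt p"
    unfolding tail_mass_def m1 by (rule real_sqrt_divide)
  have t0: "tail_mass p l = sqrt m / sqrt p"
    unfolding tail_mass_def m_def by (rule real_sqrt_divide)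
  have "opt_mass p l * tail_mass p l = (sqrt (m + 1) * sqrt m - sqrt m * sqrt m) / (sqrt p * sqrt p)"
    unfolding opt_mass_def t1 t0 by (simp add: algebra_simps diff_divide_distrib)
  hence eq: "opt_mass p l * tail_mass p l = (sqrt (m * (m + 1)) - m) / p"
    using m by (simp add: real_sqrt_mult mult.commute)
  \<comment> \<open>The bound is the expansion of \<open>sqrt (m (m + 1))\<close> for large
    \<open>m\<close>, cut after its third term.\<close>
  have "(m + 1 / 2 - 1 / (8 * m))\<^sup>2 = m * (m + 1) - (1 / 8 - 1 / (64 * m)) / m"
    using m by (simp add: power2_eq_square field_simps)
  also have "\<dots> \<le> m * (m + 1)"
    using m by (simp add: field_simps)
  finally have "m + 1 / 2 - 1 / (8 * m) \<le> sqrt (m * (m + 1))"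
    by (rule real_le_rsqrt)
  thus ?thesis using assms unfolding eq m_def[symmetric]
    by (intro divide_right_mono) auto
qed

text \<open>The balance behind the square root: there are \<open>p - j\<close> summands of at most
  \<open>1/(2p)\<close>, and the logarithm is at most \<open>1/(2(p - j))\<close>, so every class
  \<open>j\<close> gets the same bound. Up to sign, the left-hand side is the slope of the tangent
  in the direction of class \<open>j\<close>.\<close>

lemma sum_opt_mass_tail_mass_shrink_le:
  assumes "1 \<le> j" "j < p"
  shows "(\<Sum>l\<in>{j..<p}. opt_mass p l * tail_mass p l) * (- ln (shrink p j)) \<le> 1 / (4 * real p)"
proof -
  define m where "m = real (p - j)"
  have m: "1 \<le> m" using assms by (simp add: m_def)
  have m1: "real (p - (j - 1)) = m + 1" using assms by (simp add: m_def of_nat_diff)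
  have "shrink p j = sqrt (m / real p) / sqrt ((m + 1) / real p)"
    unfolding shrink_def tail_mass_def m1 m_def by (rule refl)
  hence shr: "shrink p j = sqrt (m / (m + 1))"
    using assms by (simp add: real_sqrt_divide)
  have ln: "- ln (shrink p j) = ln (1 + 1 / m) / 2"
  proof -
    have "1 + 1 / m = (m + 1) / m" using m by (simp add: field_simps)
    moreover have "ln (shrink p j) = ln (m / (m + 1)) / 2"
      unfolding shr using m by (intro ln_sqrt) auto
    ultimately show ?thesis using m by (simp add: ln_div)
  qed
  have ln_le: "- ln (shrink p j) \<le> 1 / (2 * m)"
    unfolding ln using m ln_add_one_self_le_self[of "1 / m"] by (simp add: field_simps)
  have ln_ge: "0 \<le> - ln (shrink p j)" unfolding ln using m by simp
  have "(\<Sum>l\<in>{j..<p}. opt_mass p l * tail_mass p l) \<le> (\<Sum>l\<in>{j..<p}. 1 / (2 * real p))"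
    using assms by (intro sum_mono opt_mass_tail_mass_le) auto
  also have "\<dots> = m / (2 * real p)" by (simp add: m_def)
  finally have "(\<Sum>l\<in>{j..<p}. opt_mass p l * tail_mass p l) * (- ln (shrink p j))
      \<le> m / (2 * real p) * (1 / (2 * m))"
    using ln_le ln_ge m by (intro mult_mono) auto
  also have "\<dots> = 1 / (4 * real p)" using m by (simp add: field_simps)
  finally show ?thesis .
qed

text \<open>Passing from \<open>n\<close> to \<open>n + 1\<close> adds
  \<open>n ln ((n + 1)/n)\<close>, which is at least \<open>1 - 1/(n + 1)\<close>.\<close>

lemma sum_ln_ratio_ge:
  assumes "1 \<le> p"
  shows "real p - harm p \<le> (\<Sum>m\<in>{1..<p}. ln (real p / real m))"
  using assms
proof (induction p rule: dec_induct)
  case base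
  show ?case by (simp add: harm_def)
next
  case (step n)
  have n: "real n > 0" using step by simp
  have "- ln (real (Suc n) / real n) = ln (1 + - (1 / (real n + 1)))"
    using n by (simp add: ln_div field_simps)
  also have "\<dots> \<le> - (1 / (real n + 1))"
    using n by (intro ln_add_one_self_le_self2) (auto simp: field_simps)
  finally have "real n * (1 / (real n + 1)) \<le> real n * ln (real (Suc n) / real n)"
    using n by (intro mult_left_mono) auto
  hence key: "1 - 1 / (real n + 1) \<le> real n * ln (real (Suc n) / real n)"
    using n by (simp add: field_simps)
  have "(\<Sum>m\<in>{1..<Suc n}. ln (real (Suc n) / real m))
      = (\<Sum>m\<in>{1..<Suc n}. ln (real n / real m) + ln (real (Suc n) / real n))"
    using n by (intro sum.cong refl) (auto simp: ln_div)
  also have "\<dots> = (\<Sum>m\<in>{1..<Suc n}. ln (real n / real m)) + real n * ln (real (Suc n) / real n)"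
    by (simp add: sum.distrib)
  also have "(\<Sum>m\<in>{1..<Suc n}. ln (real n / real m)) = (\<Sum>m\<in>{1..<n}. ln (real n / real m))"
    using step by simp
  finally have "(\<Sum>m\<in>{1..<Suc n}. ln (real (Suc n) / real m))
      = (\<Sum>m\<in>{1..<n}. ln (real n / real m)) + real n * ln (real (Suc n) / real n)" .
  moreover have "harm (Suc n) = harm n + 1 / (real n + 1)"
    by (simp add: harm_Suc inverse_eq_divide add.commute)
  ultimately show ?case using step.IH key by linarith
qed

text \<open>The right-hand side is a Riemann sum for the integral of \<open>1/2 - ln (1 - x) / 4\<close> over \<open>[0, 1]\<close>,
  which is \<open>3/4\<close>.\<close>

lemma tangent_sum_ge:
  assumes "2 \<le> p"
  shows "3 / 4 - (1 / 2 + 3 / 8 * harm p + (harm p)\<^sup>2 / 16) / real p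
    \<le> (\<Sum>l\<in>{1..<p}. opt_mass p l * tail_mass p l * (1 - ln (tail_mass p l)))"
proof -
  define H :: real where "H = harm p"
  define g where "g m = 1 + ln (real p / real m) / 2" for m :: nat
  have p: "real p > 0" using assms by simp
  have lnB: "1 - ln (tail_mass p l) = g (p - l)" if "l \<in> {1..<p}" for l
  proof -
    have "ln (tail_mass p l) = ln (real (p - l) / real p) / 2"
      using that unfolding tail_mass_def by (intro ln_sqrt) auto
    also have "ln (real (p - l) / real p) = - ln (real p / real (p - l))"
      using that by (simp add: ln_div del: of_nat_diff)
    finally show ?thesis by (simp add: g_def)
  qed
  have g1: "1 \<le> g m" if "m \<in> {1..<p}" for m
    using that by (simp add: g_def ln_ge_zero)
  have "harm p = harm (p - 1) + 1 / real p"
    using harm_Suc[of "p - 1", where 'a = real] assms by (simp add: inverse_eq_divide)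
  moreover have "ln (real p) \<le> harm (p - 1)"
    using ln_le_harm[of "p - 1"] assms by (simp add: of_nat_diff)
  ultimately have lnH: "ln (real p) \<le> H" and H1: "harm (p - 1) \<le> H" 
    by (simp_all add: H_def) (meson add_increasing2 of_nat_0_le_iff zero_le_divide_1_iff)
  have H0: "0 \<le> H" unfolding H_def by (rule harm_nonneg)
  have gle: "g m \<le> 1 + H / 2" if "m \<in> {1..<p}" for m
  proof -
    have "ln (real p / real m) \<le> ln (real p)"
      using that by (simp add: ln_div ln_ge_zero)
    thus ?thesis using lnH by (simp add: g_def)
  qed
  have "(\<Sum>m\<in>{1..<p}. g m) = real (p - 1) + (\<Sum>m\<in>{1..<p}. ln (real p / real m)) / 2"
    by (simp add: g_def sum.distrib sum_divide_distrib)
  also have "\<dots> \<ge> real p - 1 + (real p - H) / 2"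
    using sum_ln_ratio_ge[of p] assms by (simp add: H_def of_nat_diff)
  finally have main: "real p - 1 + (real p - H) / 2 \<le> (\<Sum>m\<in>{1..<p}. g m)" .
  \<comment> \<open>The correction \<open>1/(8m)\<close> in \<open>opt_mass_tail_mass_ge\<close>
    costs only a term of order \<open>H^2\<close>: \<open>g\<close> is at most
    \<open>1 + H/2\<close> and the reciprocals sum to at most \<open>H\<close>.\<close>
  have "(\<Sum>m\<in>{1..<p}. 1 / real m * g m) \<le> (\<Sum>m\<in>{1..<p}. 1 / real m * (1 + H / 2))"
    using gle by (intro sum_mono mult_left_mono) auto
  also have "\<dots> = harm (p - 1) * (1 + H / 2)"
  proof -
    have "{1..<p} = {1..p - 1}" using assms by auto
    thus ?thesis by (simp add: harm_def sum_distrib_right inverse_eq_divide)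
  qed
  also have "\<dots> \<le> H * (1 + H / 2)"
    using H1 H0 by (intro mult_right_mono) auto
  finally have err: "(\<Sum>m\<in>{1..<p}. 1 / real m * g m) \<le> H * (1 + H / 2)" .
  have "3 / 4 - (1 / 2 + 3 / 8 * H + H\<^sup>2 / 16) / real p
      = ((real p - 1 + (real p - H) / 2) / 2 - H * (1 + H / 2) / 8) / real p"
    using p by (simp add: field_simps power2_eq_square)
  also have "\<dots> \<le> ((\<Sum>m\<in>{1..<p}. g m) / 2 - (\<Sum>m\<in>{1..<p}. 1 / real m * g m) / 8) / real p"
    by (intro divide_right_mono diff_mono main err) auto
  also have "\<dots> = (\<Sum>m\<in>{1..<p}. (1 / 2 - 1 / (8 * real m)) / real p * g m)"
    by (simp add: sum_divide_distrib sum_subtractf algebra_simps diff_divide_distrib)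
  also have "\<dots> = (\<Sum>l\<in>{1..<p}. (1 / 2 - 1 / (8 * real (p - l))) / real p * g (p - l))"
    by (rule sum.reindex_bij_witness[of _ "\<lambda>l. p - l" "\<lambda>l. p - l"]) auto
  also have "\<dots> \<le> (\<Sum>l\<in>{1..<p}. opt_mass p l * tail_mass p l * g (p - l))"
  proof (intro sum_mono mult_right_mono opt_mass_tail_mass_ge)
    fix l assume "l \<in> {1..<p}"
    hence "p - l \<in> {1..<p}" by auto
    thus "0 \<le> g (p - l)" using g1 by fastforce
  qed auto
  also have "\<dots> = (\<Sum>l\<in>{1..<p}. opt_mass p l * tail_mass p l * (1 - ln (tail_mass p l)))"
    using lnB by (intro sum.cong) auto
  finally show ?thesis by (simp add: H_def)
qed

lemma harm_le_self: "harm n \<le> real n"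
proof (induction n)
  case (Suc n)
  have "inverse (real (Suc n)) \<le> 1" by (simp add: inverse_eq_divide)
  with Suc show ?case by (simp add: harm_Suc)
qed (simp add: harm_def)

lemma harm_ge_three_halves:
  assumes "2 \<le> p"
  shows "3 / 2 \<le> (harm p :: real)"
  using harm_mono[OF assms, where 'a = real] by (simp add: harm_Suc harm_def[of 0] numeral_2_eq_2)

text \<open>With \<open>H = harm p\<close>, the ratio is
  \<open>1/2 + (H^2 + H/2) / (2p - H)\<close>, so it suffices that twice the error numerator is at
  most \<open>H^2 + H/2\<close>. This holds for \<open>H >= 3/2\<close>, the value at
  \<open>p = 2\<close>.\<close>

lemma half_plus_error_le_ratio:
  assumes "2 \<le> p"
  shows "1 / 2 + (1 / 2 + 3 / 8 * harm p + (harm p)\<^sup>2 / 16) / real p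
    \<le> (real p + (harm p)\<^sup>2) / (2 * real p - harm p)"
proof -
  define H :: real where "H = harm p"
  define E where "E = 1 / 2 + 3 / 8 * H + H\<^sup>2 / 16"
  have H: "3 / 2 \<le> H" "H \<le> real p"
    using harm_ge_three_halves[OF assms] harm_le_self[of p] by (simp_all add: H_def)
  have p: "real p > 0" using assms by simp
  have "3 / 2 * H \<le> H * H" using H by (intro mult_right_mono) auto
  moreover have "4 * E = 2 + 3 / 2 * H + H * H / 4"
    by (simp add: E_def power2_eq_square)
  ultimately have "4 * E \<le> 2 * H\<^sup>2 + H" using H(1) unfolding power2_eq_square by linarith
  hence "real p * (4 * E) \<le> real p * (2 * H\<^sup>2 + H)" using p by (intro mult_left_mono) auto
  moreover have "0 \<le> H * E" using H by (simp add: E_def)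
  ultimately have "(1 / 2 + E / real p) * (2 * real p - H) \<le> real p + H\<^sup>2"
    using p by (simp add: field_simps power2_eq_square)
  thus ?thesis using H p by (simp add: pos_le_divide_eq E_def H_def)
qed

text \<open>Here \<open>c\<close> is the class map and the product is the uncovered share of
  \<open>R l\<close>. It is the exponential of a sum over \<open>S\<close>, so
  \<open>exp x >= 1 + x\<close> bounds it by its tangent at one element per class, where the product
  telescopes to \<open>tail_mass p l\<close>. The constant part gives about \<open>3/4\<close>, and
  each of at most \<open>p\<close> elements takes away at most \<open>1/(4p)\<close>, so about
  \<open>1/2\<close> stays uncovered.\<close>

lemma no_special_value_le:
  fixes c :: "'a \<Rightarrow> nat"
  assumes p: "2 \<le> p" and S: "finite S" "card S \<le> p" "\<And>e. e \<in> S \<Longrightarrow> 1 \<le> c e"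
  shows "1 - (\<Sum>l\<in>{1..p}. opt_mass p l * (\<Prod>e\<in>S. if c e \<le> l then shrink p (c e) else 1))
    \<le> (real p + (harm p)\<^sup>2) / (2 * real p - harm p)"
proof -
  define P where "P l = (\<Prod>e\<in>S. if c e \<le> l then shrink p (c e) else 1)" for l
  define L where "L l e = (if c e \<le> l then ln (shrink p (c e)) else 0)" for l e
  define u where "u l = opt_mass p l * tail_mass p l" for l
  have P_ge: "tail_mass p l * (1 - ln (tail_mass p l) + (\<Sum>e\<in>S. L l e)) \<le> P l"
    if l: "l \<in> {1..<p}" for l
  proof -
    have "P l = (\<Prod>e\<in>S. exp (L l e))"
      unfolding P_def L_def using S l shrink_pos[of _ p] by (intro prod.cong) auto
    also have "\<dots> = exp (\<Sum>e\<in>S. L l e)" using S by (simp add: exp_sum)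
    also have "\<dots> = tail_mass p l * exp ((\<Sum>e\<in>S. L l e) - ln (tail_mass p l))"
      using l tail_mass_pos[of l p] by (simp add: exp_diff)
    also have "\<dots> \<ge> tail_mass p l * (1 + ((\<Sum>e\<in>S. L l e) - ln (tail_mass p l)))"
      by (intro mult_left_mono exp_ge_add_one_self tail_mass_nonneg)
    finally show ?thesis by (simp add: algebra_simps)
  qed
  have col: "(\<Sum>l\<in>{1..<p}. u l * (- L l e)) \<le> 1 / (4 * real p)" if e: "e \<in> S" for e
  proof -
    have "(\<Sum>l\<in>{1..<p}. u l * (- L l e)) = (\<Sum>l\<in>{c e..<p}. u l * (- ln (shrink p (c e))))"
      using S(3)[OF e] by (intro sum.mono_neutral_cong_right) (auto simp: L_def)
    also have "\<dots> = (\<Sum>l\<in>{c e..<p}. u l) * (- ln (shrink p (c e)))"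
      by (simp add: sum_distrib_right sum_negf)
    also have "\<dots> \<le> 1 / (4 * real p)"
    proof (cases "c e < p")
      case True
      thus ?thesis using sum_opt_mass_tail_mass_shrink_le[of "c e" p] S(3)[OF e] by (simp add: u_def)
    qed auto
    finally show ?thesis .
  qed
  have "(\<Sum>l\<in>{1..<p}. u l * (\<Sum>e\<in>S. - L l e)) = (\<Sum>e\<in>S. \<Sum>l\<in>{1..<p}. u l * (- L l e))"
    by (subst sum.swap) (simp add: sum_distrib_left)
  also have "\<dots> \<le> (\<Sum>e\<in>S. 1 / (4 * real p))" by (intro sum_mono col)
  also have "\<dots> = real (card S) / (4 * real p)" by simp
  also have "\<dots> \<le> 1 / 4" using S p by (simp add: field_simps)
  finally have cross: "(\<Sum>l\<in>{1..<p}. u l * (\<Sum>e\<in>S. - L l e)) \<le> 1 / 4" .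
  have "(\<Sum>l\<in>{1..<p}. u l * (1 - ln (tail_mass p l))) - (\<Sum>l\<in>{1..<p}. u l * (\<Sum>e\<in>S. - L l e))
      = (\<Sum>l\<in>{1..<p}. opt_mass p l * (tail_mass p l * (1 - ln (tail_mass p l) + (\<Sum>e\<in>S. L l e))))"
    unfolding sum_subtractf[symmetric] by (intro sum.cong) (auto simp: u_def sum_negf algebra_simps)
  also have "\<dots> \<le> (\<Sum>l\<in>{1..<p}. opt_mass p l * P l)"
    by (intro sum_mono mult_left_mono P_ge opt_mass_nonneg)
  \<comment> \<open>The region \<open>l = p\<close> stayed out of the tangent bound because
    \<open>shrink p p = 0\<close> has no logarithm; it only adds a nonnegative term.\<close>
  also have "\<dots> \<le> (\<Sum>l\<in>{1..p}. opt_mass p l * P l)"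
    by (intro sum_mono2) (auto simp: P_def intro!: mult_nonneg_nonneg opt_mass_nonneg prod_nonneg shrink_nonneg)
  finally have "1 - (\<Sum>l\<in>{1..p}. opt_mass p l * P l)
      \<le> 1 / 2 + (1 / 2 + 3 / 8 * harm p + (harm p)\<^sup>2 / 16) / real p"
    using cross tangent_sum_ge[OF p] by (simp add: u_def)
  also note half_plus_error_le_ratio[OF p]
  finally show ?thesis by (simp add: P_def)
qed

section \<open>Coverage functions from independent random sets\<close>

text \<open>The points of the universe are all sets of ground elements, encoded as numbers; a point \<open>Z\<close>
  lies in exactly the elements \<open>elem N e\<close> with \<open>e \<in> Z\<close>, so every weighted coverage function on
  \<open>N\<close> elements arises from a choice of point weights.\<close>

definition elem :: "nat \<Rightarrow> nat \<Rightarrow> nat set" where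
  "elem N e = set_encode ` {Z. Z \<subseteq> {..<N} \<and> e \<in> Z}"

text \<open>The weight of \<open>Z\<close> is the \<open>w\<close>-mixture of the probabilities that a random set, containing each
  \<open>e\<close> independently with probability \<open>q l e\<close>, equals \<open>Z\<close>.\<close>

definition mix_weight ::
  "nat \<Rightarrow> 'l set \<Rightarrow> ('l \<Rightarrow> real) \<Rightarrow> ('l \<Rightarrow> nat \<Rightarrow> real) \<Rightarrow> nat \<Rightarrow> real" where
  "mix_weight N L w q u = (if u \<in> set_encode ` Pow {..<N}
     then \<Sum>l\<in>L. w l * ((\<Prod>e\<in>set_decode u. q l e) * (\<Prod>e\<in>{..<N} - set_decode u. 1 - q l e))
     else 0)"

lemma finite_elem: "finite (elem N e)"
proof -
  have "{Z. Z \<subseteq> {..<N} \<and> e \<in> Z} \<subseteq> Pow {..<N}" by auto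
  thus ?thesis unfolding elem_def by (meson finite_Pow_iff finite_imageI finite_lessThan finite_subset)
qed

lemma inj_on_set_encode_Pow: "inj_on set_encode (Pow {..<N})"
  by (rule inj_on_subset[OF inj_on_set_encode]) (auto intro: finite_subset)

text \<open>The point encoding \<open>{d}\<close> lies in \<open>elem N d\<close> and in no other
  element.\<close>

lemma inj_on_elem: "inj_on (elem N) {..<N}"
proof (rule inj_onI)
  fix d e assume de: "d \<in> {..<N}" "e \<in> {..<N}" "elem N d = elem N e"
  have "set_encode {d} \<in> elem N d" unfolding elem_def using de(1) by (intro imageI) simp
  hence "set_encode {d} \<in> elem N e" using de by simp
  then obtain Z where Z: "Z \<subseteq> {..<N}" "e \<in> Z" "set_encode {d} = set_encode Z"
    unfolding elem_def by auto
  have "{d} = Z"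
    using Z de by (intro inj_onD[OF inj_on_set_encode_Pow[of N] Z(3)]) auto
  thus "d = e" using Z by auto
qed

lemma mix_weight_nonneg:
  assumes "\<And>l. l \<in> L \<Longrightarrow> 0 \<le> w l" "\<And>l e. l \<in> L \<Longrightarrow> 0 \<le> q l e \<and> q l e \<le> 1"
  shows "0 \<le> mix_weight N L w q u"
  using assms by (auto simp: mix_weight_def intro!: sum_nonneg mult_nonneg_nonneg prod_nonneg)

text \<open>Missing \<open>S\<close> means being a subset of \<open>A - S\<close>. Expanding the
  product of \<open>q e + (1 - q e)\<close> shows that the probabilities sum to one, over
  \<open>A\<close> and again over \<open>A - S\<close>.\<close>

lemma sum_random_set_hits:
  fixes q :: "'a \<Rightarrow> real"
  assumes "finite A" "S \<subseteq> A"
  shows "(\<Sum>Z\<in>{Z \<in> Pow A. Z \<inter> S \<noteq> {}}. (\<Prod>e\<in>Z. q e) * (\<Prod>e\<in>A - Z. 1 - q e))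
    = 1 - (\<Prod>e\<in>S. 1 - q e)"
proof -
  let ?f = "\<lambda>Z. (\<Prod>e\<in>Z. q e) * (\<Prod>e\<in>A - Z. 1 - q e)"
  have fin: "finite S" "finite (A - S)" using assms finite_subset by auto
  have all: "sum ?f (Pow A) = 1"
    using prod_add[OF assms(1), of q "\<lambda>e. 1 - q e"] by simp
  have "sum ?f (Pow (A - S))
      = (\<Sum>Z\<in>Pow (A - S). (\<Prod>e\<in>S. 1 - q e) * ((\<Prod>e\<in>Z. q e) * (\<Prod>e\<in>(A - S) - Z. 1 - q e)))"
  proof (rule sum.cong)
    fix Z assume Z: "Z \<in> Pow (A - S)"
    have "A - Z = S \<union> ((A - S) - Z)" using Z assms by auto
    hence "(\<Prod>e\<in>A - Z. 1 - q e) = (\<Prod>e\<in>S. 1 - q e) * (\<Prod>e\<in>(A - S) - Z. 1 - q e)"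
      using fin by (metis Diff_disjoint Int_Diff empty_Diff finite_Diff prod.union_disjoint)
    thus "?f Z = (\<Prod>e\<in>S. 1 - q e) * ((\<Prod>e\<in>Z. q e) * (\<Prod>e\<in>(A - S) - Z. 1 - q e))"
      by simp
  qed simp
  also have "\<dots> = (\<Prod>e\<in>S. 1 - q e)"
    using prod_add[OF fin(2), of q "\<lambda>e. 1 - q e"] by (simp flip: sum_distrib_left)
  finally have miss: "sum ?f (Pow (A - S)) = (\<Prod>e\<in>S. 1 - q e)" .
  have "{Z \<in> Pow A. Z \<inter> S \<noteq> {}} = Pow A - Pow (A - S)" by auto
  moreover have "sum ?f (Pow A - Pow (A - S)) = sum ?f (Pow A) - sum ?f (Pow (A - S))"
    using assms by (intro sum_diff) auto
  ultimately show ?thesis using all miss by simp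
qed

lemma cov_mix_weight:
  assumes "S \<subseteq> {..<N}"
  shows "cov (mix_weight N L w q) (elem N ` S) = (\<Sum>l\<in>L. w l * (1 - (\<Prod>e\<in>S. 1 - q l e)))"
proof -
  let ?P = "{Z \<in> Pow {..<N}. Z \<inter> S \<noteq> {}}"
  \<comment> \<open>A point is covered exactly when, as a set, it meets \<open>S\<close>.\<close>
  have U: "\<Union>(elem N ` S) = set_encode ` ?P" by (auto simp: elem_def)
  have "cov (mix_weight N L w q) (elem N ` S) = (\<Sum>Z\<in>?P. mix_weight N L w q (set_encode Z))"
    unfolding cov_def U
    by (subst sum.reindex) (auto intro: inj_on_subset[OF inj_on_set_encode_Pow])
  also have "\<dots> = (\<Sum>Z\<in>?P. \<Sum>l\<in>L. w l * ((\<Prod>e\<in>Z. q l e) * (\<Prod>e\<in>{..<N} - Z. 1 - q l e)))"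
  proof (rule sum.cong)
    fix Z assume "Z \<in> ?P"
    hence "Z \<subseteq> {..<N}" "finite Z" by (auto intro: finite_subset)
    thus "mix_weight N L w q (set_encode Z)
        = (\<Sum>l\<in>L. w l * ((\<Prod>e\<in>Z. q l e) * (\<Prod>e\<in>{..<N} - Z. 1 - q l e)))"
      by (auto simp: mix_weight_def)
  qed simp
  also have "\<dots> = (\<Sum>l\<in>L. w l * (1 - (\<Prod>e\<in>S. 1 - q l e)))"
    unfolding sum.swap[of _ L] sum_distrib_left[symmetric]
    using assms by (intro sum.cong refl arg_cong2[of _ _ _ _ "(*)"] sum_random_set_hits) auto
  finally show ?thesis .
qed

section \<open>One-way messages\<close>

lemma measure_bind_pmf_finite:
  assumes "finite B" "set_pmf M \<subseteq> B"
  shows "measure (measure_pmf (bind_pmf M f)) X = (\<Sum>m\<in>B. measure (measure_pmf (f m)) X * pmf M m)"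
proof -
  have pm: "measure (measure_pmf D) X = pmf (map_pmf (\<lambda>T. T \<in> X) D) True" for D
    by (simp add: pmf_map vimage_def)
  have "measure (measure_pmf (bind_pmf M f)) X = (\<integral>m. measure (measure_pmf (f m)) X \<partial>measure_pmf M)"
    unfolding pm by (simp add: map_bind_pmf pmf_bind)
  also have "\<dots> = (\<Sum>m\<in>B. measure (measure_pmf (f m)) X * pmf M m)"
    using assms by (intro integral_measure_pmf_real) auto
  finally show ?thesis .
qed

lemma card_bool_lists_length_le: "card {m :: bool list. length m \<le> L} \<le> 2 ^ Suc L"
proof -
  have "card {m :: bool list. length m \<le> L} = (\<Sum>i\<le>L. 2 ^ i)"
    using card_lists_length_le[of "UNIV :: bool set" L] by simp
  also have "\<dots> \<le> 2 ^ Suc L" by (induction L) auto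
  finally show ?thesis .
qed

lemma finite_bool_lists_length_le: "finite {m :: bool list. length m \<le> L}"
  using finite_lists_length_le[of "UNIV :: bool set" L] by simp

text \<open>Strings in \<open>C\<close> share their values on \<open>D\<close>, so each is
  determined by its restriction to the complement of \<open>D\<close>.\<close>

lemma card_agreeing_le:
  assumes "C \<subseteq> {..<s} \<rightarrow>\<^sub>E (UNIV :: bool set)" "D \<subseteq> {..<s}"
    and "\<And>X Y j. X \<in> C \<Longrightarrow> Y \<in> C \<Longrightarrow> j \<in> D \<Longrightarrow> X j = Y j"
  shows "card C * 2 ^ card D \<le> 2 ^ s"
proof -
  let ?R = "\<lambda>X. restrict X ({..<s} - D)"
  have finD: "finite D" using assms(2) finite_subset by blast
  have "inj_on ?R C"
  proof (rule inj_onI)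
    fix X Y assume XY: "X \<in> C" "Y \<in> C" "?R X = ?R Y"
    show "X = Y"
    proof
      fix j
      consider "j \<in> D" | "j \<in> {..<s} - D" | "j \<notin> {..<s}" by blast
      thus "X j = Y j"
      proof cases
        case 1
        thus ?thesis using assms XY by blast
      next
        case 2
        thus ?thesis using XY(3) by (metis restrict_apply')
      next
        case 3
        thus ?thesis using XY assms(1) by (metis PiE_arb subsetD)
      qed
    qed
  qed
  moreover have "?R ` C \<subseteq> ({..<s} - D) \<rightarrow>\<^sub>E UNIV" by auto
  ultimately have "card C \<le> card (({..<s} - D) \<rightarrow>\<^sub>E (UNIV :: bool set))"
    by (intro card_inj_on_le[of ?R]) (auto intro!: finite_PiE)
  also have "\<dots> = 2 ^ (s - card D)"
    using assms(2) finD by (simp add: card_funcsetE card_Diff_subset)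
  finally have "card C * 2 ^ card D \<le> 2 ^ (s - card D) * 2 ^ card D" by simp
  also have "\<dots> = 2 ^ s"
    using card_mono[OF _ assms(2)] by (simp flip: power_add)
  finally show ?thesis .
qed

text \<open>Trades a count \<open>n\<close> for a threshold \<open>K\<close> and an exponential
  excess; \<open>card_agreeing_le\<close> controls the latter on average.\<close>

lemma nat_le_add_power2_ratio: "real n \<le> real K + 2 ^ n / 2 ^ K"
proof (cases "n \<le> K")
  case True
  thus ?thesis by (simp add: add_increasing2)
next
  case False
  have "real (n - K) \<le> 2 ^ (n - K)" by (rule order_less_imp_le[OF of_nat_less_two_power])
  thus ?thesis using False by (simp add: power_diff of_nat_diff)
qed

text \<open>If a guess \<open>b\<close> for coordinate \<open>j\<close> is made with positive probability only when it is certain,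
  then the guessed coordinates are constant on the set of strings compatible with the message,
  and this set is exponentially small in their number.\<close>

lemma certain_guesses_le:
  fixes s L :: nat and M :: "(nat \<Rightarrow> bool) \<Rightarrow> bool list pmf" and g :: "bool list \<Rightarrow> nat \<Rightarrow> bool \<Rightarrow> real"
  defines "Xs \<equiv> {..<s} \<rightarrow>\<^sub>E (UNIV :: bool set)" and "Ms \<equiv> {m. length m \<le> L}"
  assumes len: "\<And>X. X \<in> Xs \<Longrightarrow> set_pmf (M X) \<subseteq> Ms"
    and g: "\<And>m j b. g m j b \<le> 1"
    and certain: "\<And>X m j b. X \<in> Xs \<Longrightarrow> m \<in> set_pmf (M X) \<Longrightarrow> j < s \<Longrightarrow> g m j b > 0 \<Longrightarrow> X j = b"
  shows "(\<Sum>X\<in>Xs. \<Sum>j<s. \<Sum>m\<in>Ms. g m j (X j) * pmf (M X) m) \<le> (real L + 2) * 2 ^ s"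
proof -
  define C where "C m = {X \<in> Xs. m \<in> set_pmf (M X)}" for m
  define D where "D m = {j \<in> {..<s}. \<forall>X\<in>C m. \<forall>Y\<in>C m. X j = Y j}" for m
  have finXs: "finite Xs" unfolding Xs_def by (intro finite_PiE) auto
  have cardXs: "card Xs = 2 ^ s" unfolding Xs_def by (simp add: card_funcsetE)
  have finMs: "finite Ms" unfolding Ms_def by (rule finite_bool_lists_length_le)
  have row: "(\<Sum>j<s. g m j (X j)) * pmf (M X) m \<le> real (card (D m)) * pmf (M X) m"
    if X: "X \<in> Xs" for X m
  proof (cases "m \<in> set_pmf (M X)")
    case True
    have "g m j (X j) \<le> of_bool (j \<in> D m)" if j: "j < s" for j
    proof (cases "g m j (X j) > 0")
      case True
      have "Y j = X j" if "Y \<in> C m" for Y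
        using certain[OF _ _ j True, of Y] that by (simp add: C_def)
      hence "j \<in> D m" using j unfolding D_def by blast
      thus ?thesis using g by simp
    qed auto
    hence "(\<Sum>j<s. g m j (X j)) \<le> (\<Sum>j<s. of_bool (j \<in> D m))"
      by (intro sum_mono) auto
    also have "\<dots> = real (card (D m))"
      by (simp add: of_bool_def sum.If_cases D_def Int_def)
    finally show ?thesis by (intro mult_right_mono) auto
  qed (simp add: set_pmf_iff)
  have count: "(\<Sum>X\<in>Xs. 2 ^ card (D m) * pmf (M X) m) \<le> 2 ^ s" for m
  proof -
    have "(\<Sum>X\<in>Xs. pmf (M X) m) = (\<Sum>X\<in>C m. pmf (M X) m)"
      using finXs by (intro sum.mono_neutral_right) (auto simp: C_def set_pmf_iff)
    also have "\<dots> \<le> real (card (C m)) * 1"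
      by (intro sum_bounded_above pmf_le_1)
    finally have "2 ^ card (D m) * (\<Sum>X\<in>Xs. pmf (M X) m) \<le> 2 ^ card (D m) * real (card (C m))"
      by simp
    also have "card (C m) * 2 ^ card (D m) \<le> 2 ^ s"
      by (rule card_agreeing_le) (auto simp: C_def D_def Xs_def)
    hence "real (card (C m) * 2 ^ card (D m)) \<le> real (2 ^ s)"
      by (simp only: of_nat_le_iff)
    hence "2 ^ card (D m) * real (card (C m)) \<le> 2 ^ s"
      by (simp add: mult.commute)
    finally show ?thesis by (simp add: sum_distrib_left)
  qed
  have one: "(\<Sum>m\<in>Ms. pmf (M X) m) = 1" if "X \<in> Xs" for X
    using len[OF that] finMs by (intro sum_pmf_eq_1) auto
  \<comment> \<open>There are at most \<open>2 ^ Suc L\<close> messages, so with this threshold the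
    exponential excess averages to at most one; together this is \<open>L + 2\<close>.\<close>
  let ?K = "Suc L"
  have "(\<Sum>X\<in>Xs. \<Sum>j<s. \<Sum>m\<in>Ms. g m j (X j) * pmf (M X) m)
      = (\<Sum>X\<in>Xs. \<Sum>m\<in>Ms. (\<Sum>j<s. g m j (X j)) * pmf (M X) m)"
    unfolding sum_distrib_right by (intro sum.cong refl sum.swap)
  also have "\<dots> \<le> (\<Sum>X\<in>Xs. \<Sum>m\<in>Ms. (real ?K + 2 ^ card (D m) / 2 ^ ?K) * pmf (M X) m)"
    by (intro sum_mono order_trans[OF row] mult_right_mono nat_le_add_power2_ratio) auto
  also have "\<dots> = (\<Sum>X\<in>Xs. real ?K * (\<Sum>m\<in>Ms. pmf (M X) m))
      + (\<Sum>X\<in>Xs. \<Sum>m\<in>Ms. 2 ^ card (D m) * pmf (M X) m) / 2 ^ ?K"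
    by (simp add: distrib_right sum.distrib sum_distrib_left sum_divide_distrib del: power_Suc of_nat_Suc)
  also have "(\<Sum>X\<in>Xs. real ?K * (\<Sum>m\<in>Ms. pmf (M X) m)) = 2 ^ s * real ?K"
    using one by (simp add: cardXs)
  also have "(\<Sum>X\<in>Xs. \<Sum>m\<in>Ms. 2 ^ card (D m) * pmf (M X) m) \<le> (\<Sum>m\<in>Ms. 2 ^ s)"
    by (subst sum.swap) (intro sum_mono count)
  also have "\<dots> = real (card Ms) * 2 ^ s" by simp
  also have "\<dots> \<le> real (2 ^ ?K) * 2 ^ s"
    unfolding Ms_def by (intro mult_right_mono of_nat_mono card_bool_lists_length_le) simp
  finally show ?thesis by (simp add: divide_right_mono field_simps)
qed

lemma sum_PiE_remove:
  assumes "i \<in> I"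
  shows "(\<Sum>z\<in>I \<rightarrow>\<^sub>E B. h z) = (\<Sum>g\<in>(I - {i}) \<rightarrow>\<^sub>E B. \<Sum>y\<in>B. h (g(i := y)))"
proof -
  have I: "insert i (I - {i}) = I" using assms by auto
  have "I \<rightarrow>\<^sub>E B = (\<lambda>(y, g). g(i := y)) ` (B \<times> ((I - {i}) \<rightarrow>\<^sub>E B))"
    using PiE_insert_eq[of i "I - {i}" "\<lambda>_. B"] unfolding I .
  hence "(\<Sum>z\<in>I \<rightarrow>\<^sub>E B. h z) = (\<Sum>(y, g)\<in>B \<times> ((I - {i}) \<rightarrow>\<^sub>E B). h (g(i := y)))"
    using inj_combinator[of i "I - {i}" "\<lambda>_. B"]
    by (simp add: sum.reindex case_prod_unfold o_def)
  also have "\<dots> = (\<Sum>y\<in>B. \<Sum>g\<in>(I - {i}) \<rightarrow>\<^sub>E B. h (g(i := y)))"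
    by (simp add: sum.cartesian_product)
  finally show ?thesis by (subst (asm) sum.swap)
qed

section \<open>Cutting a protocol after player \<open>i\<close>\<close>

fun msgs_from where
  "msgs_from A V Orc i m 0 = return_pmf m"
| "msgs_from A V Orc i m (Suc d) =
     bind_pmf (msgs_from A V Orc i m d) (A (Suc (i + d)) (V (Suc (i + d))) (Orc (Suc (i + d))))"

lemma msgs_add: "msgs A V Orc (i + d) = bind_pmf (msgs A V Orc i) (\<lambda>m. msgs_from A V Orc i m d)"
  by (induction d) (simp_all add: bind_return_pmf' bind_assoc_pmf)

text \<open>Player \<open>p\<close> sends no message, so \<open>p - 1 - i\<close> messages follow
  that of player \<open>i\<close>.\<close>

definition output_from where
  "output_from A Out p V Orc i m = bind_pmf (msgs_from A V Orc i m (p - 1 - i)) (Out (V p) (Orc p))"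

lemma prot_output_split:
  assumes "i < p"
  shows "prot_output A Out p V Orc = bind_pmf (msgs A V Orc i) (output_from A Out p V Orc i)"
proof -
  have "p - 1 = i + (p - 1 - i)" using assms by simp
  thus ?thesis unfolding prot_output_def output_from_def
    by (metis bind_assoc_pmf msgs_add)
qed

lemma msgs_cong:
  assumes "\<And>j. 1 \<le> j \<Longrightarrow> j \<le> i \<Longrightarrow> V j = V' j \<and> Orc j = Orc' j"
  shows "msgs A V Orc i = msgs A V' Orc' i"
  using assms by (induction i) auto

lemma msgs_from_cong:
  assumes "\<And>j. i < j \<Longrightarrow> j \<le> i + d \<Longrightarrow> V j = V' j \<and> Orc j = Orc' j"
  shows "msgs_from A V Orc i m d = msgs_from A V' Orc' i m d"
  using assms by (induction d) auto

lemma output_from_cong: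
  assumes "i < p" "\<And>j. i < j \<Longrightarrow> j \<le> p \<Longrightarrow> V j = V' j \<and> Orc j = Orc' j"
  shows "output_from A Out p V Orc i m = output_from A Out p V' Orc' i m"
proof -
  have "msgs_from A V Orc i m (p - 1 - i) = msgs_from A V' Orc' i m (p - 1 - i)"
    using assms by (intro msgs_from_cong) auto
  thus ?thesis using assms by (simp add: output_from_def)
qed

section \<open>The hard family of instances\<close>

text \<open>Each class has \<open>s\<close> pairs; elements outside these pairs pad the ground set
  to size \<open>N\<close> and are never offered.\<close>

locale hard_family =
  fixes p s N :: nat
  assumes p: "2 \<le> p" and s: "1 \<le> s" and N: "2 * p * s \<le> N"
begin

definition cls :: "nat \<Rightarrow> nat" where
  "cls e = Suc (e mod p)"

text \<open>The residue modulo \<open>p\<close> encodes the class, the quotient encodes member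
  \<open>b\<close> of pair \<open>j\<close>.\<close>

definition slot :: "nat \<Rightarrow> nat \<Rightarrow> bool \<Rightarrow> nat" where
  "slot i j b = (i - 1) + p * (2 * j + of_bool b)"

text \<open>Fraction of the region \<open>R l\<close> covered by the element \<open>e\<close>. In class \<open>p\<close> special and non-special
  elements coincide, because \<open>shrink p p = 0\<close>.\<close>

definition cover_prob :: "(nat \<Rightarrow> nat) \<Rightarrow> nat \<Rightarrow> nat \<Rightarrow> real" where
  "cover_prob t l e = (if e = t (cls e) then of_bool (cls e = l)
     else if cls e \<le> l then 1 - shrink p (cls e) else 0)"

definition hard_value :: "(nat \<Rightarrow> nat) \<Rightarrow> nat set \<Rightarrow> real" where
  "hard_value t S = (\<Sum>l\<in>{1..p}. opt_mass p l * (1 - (\<Prod>e\<in>S. 1 - cover_prob t l e)))"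

definition hard_weight :: "(nat \<Rightarrow> nat) \<Rightarrow> nat \<Rightarrow> real" where
  "hard_weight t = mix_weight N {1..p} (opt_mass p) (cover_prob t)"

definition part :: "nat \<Rightarrow> nat set set" where
  "part i = elem N ` {e. e < N \<and> cls e = i}"

definition offered :: "(nat \<Rightarrow> nat \<Rightarrow> bool) \<Rightarrow> nat \<Rightarrow> nat set set" where
  "offered x i = elem N ` (\<lambda>j. slot i j (x i j)) ` {..<s}"

lemma cls_bounds: "1 \<le> cls e" "cls e \<le> p"
  using p mod_less_divisor[of p e] by (auto simp: cls_def Suc_le_eq)

lemma cls_slot: "1 \<le> i \<Longrightarrow> i \<le> p \<Longrightarrow> cls (slot i j b) = i"
  using p by (simp add: cls_def slot_def del: Nat.add_diff_assoc2 Nat.diff_add_assoc2)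

lemma slot_less:
  assumes "1 \<le> i" "i \<le> p" "j < s"
  shows "slot i j b < N"
proof -
  have "slot i j b < p + p * (2 * j + 1)"
    using assms by (auto simp: slot_def of_bool_def)
  also have "\<dots> = p * (2 * (j + 1))" by (simp add: algebra_simps)
  also have "\<dots> \<le> p * (2 * s)" using assms by (intro mult_le_mono) auto
  also have "\<dots> \<le> N" using N by (simp add: mult.assoc mult.left_commute)
  finally show ?thesis .
qed

lemma slot_inject:
  assumes "slot i j b = slot i j' b'"
  shows "j = j' \<and> b = b'"
proof -
  have "2 * j + of_bool b = 2 * j' + of_bool b'"
    using assms p by (simp add: slot_def)
  thus ?thesis by (cases b; cases b') (auto, presburger+)
qed

lemma cover_prob_bounds: "0 \<le> cover_prob t l e" "cover_prob t l e \<le> 1"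
  using shrink_nonneg[of p] shrink_le_1[of p] by (auto simp: cover_prob_def)

lemma hard_weight_nonneg: "0 \<le> hard_weight t u"
  unfolding hard_weight_def
  by (intro mix_weight_nonneg opt_mass_nonneg conjI cover_prob_bounds)

lemma cov_hard_weight:
  "S \<subseteq> {..<N} \<Longrightarrow> cov (hard_weight t) (elem N ` S) = hard_value t S"
  unfolding hard_weight_def hard_value_def by (rule cov_mix_weight)

lemma sum_opt_mass_all: "(\<Sum>l\<in>{1..p}. opt_mass p l) = 1"
  using sum_opt_mass[of 1 p] p by (simp add: tail_mass_0)

lemma hard_value_eq:
  "hard_value t S = 1 - (\<Sum>l\<in>{1..p}. opt_mass p l * (\<Prod>e\<in>S. 1 - cover_prob t l e))"
  using sum_opt_mass_all by (simp add: hard_value_def right_diff_distrib sum_subtractf)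

lemma hard_value_le_1: "hard_value t S \<le> 1"
  unfolding hard_value_eq using cover_prob_bounds
  by (auto intro!: sum_nonneg mult_nonneg_nonneg opt_mass_nonneg prod_nonneg)

lemma hard_value_specials:
  assumes "\<And>i. i \<in> {1..p} \<Longrightarrow> cls (t i) = i"
  shows "hard_value t (t ` {1..p}) = 1"
proof -
  have "(\<Prod>e\<in>t ` {1..p}. 1 - cover_prob t l e) = 0" if l: "l \<in> {1..p}" for l
  proof (rule prod_zero)
    show "\<exists>e\<in>t ` {1..p}. 1 - cover_prob t l e = 0"
      using assms[OF l] l by (intro bexI[of _ "t l"]) (auto simp: cover_prob_def)
  qed simp
  hence "(\<Sum>l\<in>{1..p}. opt_mass p l * (\<Prod>e\<in>t ` {1..p}. 1 - cover_prob t l e)) = 0"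
    by (intro sum.neutral ballI) simp
  thus ?thesis by (simp only: hard_value_eq)
qed

lemma hard_value_no_special:
  assumes "finite S" "card S \<le> p" "\<And>i. 1 \<le> i \<Longrightarrow> i < p \<Longrightarrow> t i \<notin> S"
  shows "hard_value t S \<le> (real p + (harm p)\<^sup>2) / (2 * real p - harm p)"
proof -
  have "1 - cover_prob t l e = (if cls e \<le> l then shrink p (cls e) else 1)"
    if "l \<in> {1..p}" "e \<in> S" for l e
  proof (cases "e = t (cls e)")
    \<comment> \<open>Only class \<open>p\<close> may supply a special here, and there it covers
      exactly what a non-special does.\<close>
    case True
    hence "cls e = p" using assms(3)[of "cls e"] that cls_bounds[of e] by (metis le_neq_implies_less)
    thus ?thesis using True that by (auto simp: cover_prob_def shrink_self)
  qed (simp add: cover_prob_def)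
  hence "hard_value t S
      = 1 - (\<Sum>l\<in>{1..p}. opt_mass p l * (\<Prod>e\<in>S. if cls e \<le> l then shrink p (cls e) else 1))"
    unfolding hard_value_eq by simp
  also have "\<dots> \<le> (real p + (harm p)\<^sup>2) / (2 * real p - harm p)"
    using assms cls_bounds by (intro no_special_value_le p) auto
  finally show ?thesis .
qed

text \<open>Core of the indistinguishability: one non-special leaves the fraction
  \<open>shrink p i\<close> of every region from \<open>R i\<close> on; the special clears
  \<open>R i\<close> and leaves the later ones intact, of total mass \<open>tail_mass p i\<close>.
  Both leave the same mass, so only the number of elements counts.\<close>

lemma sum_last_class:
  assumes i: "1 \<le> i" "i \<le> p" and T: "finite T" "\<And>e. e \<in> T \<Longrightarrow> cls e = i"
  shows "(\<Sum>l\<in>{i..p}. opt_mass p l * (\<Prod>e\<in>T. 1 - cover_prob t l e))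
    = tail_mass p (i - 1) * shrink p i ^ card T"
proof (cases "t i \<in> T")
  case False
  have "(\<Prod>e\<in>T. 1 - cover_prob t l e) = shrink p i ^ card T" if "l \<in> {i..p}" for l
  proof -
    have "(\<Prod>e\<in>T. 1 - cover_prob t l e) = (\<Prod>e\<in>T. shrink p i)"
      using False T that by (intro prod.cong) (auto simp: cover_prob_def)
    thus ?thesis by simp
  qed
  thus ?thesis using i by (simp add: sum_opt_mass flip: sum_distrib_right)
next
  case True
  have first: "(\<Prod>e\<in>T. 1 - cover_prob t i e) = 0"
    using True T by (intro prod_zero bexI[of _ "t i"]) (auto simp: cover_prob_def)
  have later: "(\<Prod>e\<in>T. 1 - cover_prob t l e) = shrink p i ^ (card T - 1)" if "l \<in> {Suc i..p}" for l
  proof -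
    have "(\<Prod>e\<in>T. 1 - cover_prob t l e) = (\<Prod>e\<in>T - {t i}. 1 - cover_prob t l e)"
      using True T that by (subst prod.remove[of _ "t i"]) (auto simp: cover_prob_def)
    also have "\<dots> = (\<Prod>e\<in>T - {t i}. shrink p i)"
      using T that by (intro prod.cong) (auto simp: cover_prob_def)
    finally show ?thesis using T True by simp
  qed
  have "(\<Sum>l\<in>{i..p}. opt_mass p l * (\<Prod>e\<in>T. 1 - cover_prob t l e))
      = (\<Sum>l\<in>{Suc i..p}. opt_mass p l) * shrink p i ^ (card T - 1)"
    using i first later by (simp add: sum.atLeast_Suc_atMost sum_distrib_right)
  also have "(\<Sum>l\<in>{Suc i..p}. opt_mass p l) = tail_mass p (i - 1) * shrink p i"
  proof -
    have "0 < tail_mass p (i - 1)" using i by (intro tail_mass_pos) linarith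
    thus ?thesis using i sum_opt_mass[of "Suc i" p] by (simp add: shrink_def)
  qed
  also have "\<dots> * shrink p i ^ (card T - 1) = tail_mass p (i - 1) * shrink p i ^ card T"
  proof -
    have "0 < card T" using True T by (auto simp: card_gt_0_iff)
    thus ?thesis by (cases "card T") auto
  qed
  finally show ?thesis .
qed

text \<open>The right-hand side mentions \<open>t j\<close> only for \<open>j < i\<close>.\<close>

lemma hard_value_prefix:
  assumes i: "1 \<le> i" "i \<le> p" and S: "finite S" "\<And>e. e \<in> S \<Longrightarrow> cls e \<le> i"
  defines "S1 \<equiv> {e \<in> S. cls e < i}"
  shows "hard_value t S = 1 - (\<Sum>l\<in>{1..<i}. opt_mass p l * (\<Prod>e\<in>S1. 1 - cover_prob t l e))
    - (\<Prod>e\<in>S1. if e = t (cls e) then 1 else shrink p (cls e))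
      * (tail_mass p (i - 1) * shrink p i ^ card {e \<in> S. cls e = i})"
proof -
  define S2 where "S2 = {e \<in> S. cls e = i}"
  have split: "(\<Prod>e\<in>S. 1 - cover_prob t l e)
      = (\<Prod>e\<in>S1. 1 - cover_prob t l e) * (\<Prod>e\<in>S2. 1 - cover_prob t l e)" for l
  proof -
    have "S = S1 \<union> S2" "S1 \<inter> S2 = {}" "finite S1" "finite S2"
      using S by (auto simp: S1_def S2_def le_neq_implies_less)
    thus ?thesis by (metis prod.union_disjoint)
  qed
  have "{1..p} = {1..<i} \<union> {i..p}" using i by auto
  hence "(\<Sum>l\<in>{1..p}. opt_mass p l * (\<Prod>e\<in>S. 1 - cover_prob t l e))
      = (\<Sum>l\<in>{1..<i}. opt_mass p l * (\<Prod>e\<in>S. 1 - cover_prob t l e))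
      + (\<Sum>l\<in>{i..p}. opt_mass p l * (\<Prod>e\<in>S. 1 - cover_prob t l e))"
    by (simp only:) (intro sum.union_disjoint, auto)
  also have "(\<Sum>l\<in>{1..<i}. opt_mass p l * (\<Prod>e\<in>S. 1 - cover_prob t l e))
      = (\<Sum>l\<in>{1..<i}. opt_mass p l * (\<Prod>e\<in>S1. 1 - cover_prob t l e))"
  proof (intro sum.cong refl)
    fix l assume "l \<in> {1..<i}"
    hence "(\<Prod>e\<in>S2. 1 - cover_prob t l e) = 1"
      by (intro prod.neutral) (auto simp: S2_def cover_prob_def)
    thus "opt_mass p l * (\<Prod>e\<in>S. 1 - cover_prob t l e) = opt_mass p l * (\<Prod>e\<in>S1. 1 - cover_prob t l e)"
      by (simp add: split)
  qed
  \<comment> \<open>From \<open>R i\<close> on, the factor of an earlier element no longer depends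
    on \<open>l\<close>, as earlier specials cover nothing there; so it can be pulled out.\<close>
  also have "(\<Sum>l\<in>{i..p}. opt_mass p l * (\<Prod>e\<in>S. 1 - cover_prob t l e))
      = (\<Sum>l\<in>{i..p}. (\<Prod>e\<in>S1. if e = t (cls e) then 1 else shrink p (cls e))
          * (opt_mass p l * (\<Prod>e\<in>S2. 1 - cover_prob t l e)))"
  proof (intro sum.cong refl)
    fix l assume "l \<in> {i..p}"
    hence "(\<Prod>e\<in>S1. 1 - cover_prob t l e) = (\<Prod>e\<in>S1. if e = t (cls e) then 1 else shrink p (cls e))"
      by (intro prod.cong) (auto simp: S1_def cover_prob_def)
    thus "opt_mass p l * (\<Prod>e\<in>S. 1 - cover_prob t l e)
        = (\<Prod>e\<in>S1. if e = t (cls e) then 1 else shrink p (cls e))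
          * (opt_mass p l * (\<Prod>e\<in>S2. 1 - cover_prob t l e))"
      by (simp add: split)
  qed
  also have "\<dots> = (\<Prod>e\<in>S1. if e = t (cls e) then 1 else shrink p (cls e))
      * (tail_mass p (i - 1) * shrink p i ^ card S2)"
    unfolding sum_distrib_left[symmetric] using S
    by (subst sum_last_class[OF i]) (auto simp: S2_def)
  finally show ?thesis unfolding hard_value_eq S2_def by simp
qed

lemma hard_value_cong:
  assumes i: "1 \<le> i" "i \<le> p" and S: "finite S" "\<And>e. e \<in> S \<Longrightarrow> cls e \<le> i"
    and t: "\<And>j. 1 \<le> j \<Longrightarrow> j < i \<Longrightarrow> t j = t' j"
  shows "hard_value t S = hard_value t' S"
proof -
  have "t (cls e) = t' (cls e)" if "cls e < i" for e
    using that t cls_bounds(1) by simp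
  hence "(\<Prod>e\<in>{e \<in> S. cls e < i}. if e = t (cls e) then 1 else shrink p (cls e))
      = (\<Prod>e\<in>{e \<in> S. cls e < i}. if e = t' (cls e) then 1 else shrink p (cls e))"
    and "(\<Prod>e\<in>{e \<in> S. cls e < i}. 1 - cover_prob t l e)
      = (\<Prod>e\<in>{e \<in> S. cls e < i}. 1 - cover_prob t' l e)" for l
    by (auto simp: cover_prob_def intro!: prod.cong)
  thus ?thesis
    using hard_value_prefix[OF i S, of t] hard_value_prefix[OF i S, of t'] by simp
qed

text \<open>The strict \<open>j < i\<close> is essential: the oracle of player \<open>i\<close>
  hides even the special of its own class.\<close>

lemma val_access_cong:
  assumes i: "1 \<le> i" "i \<le> p" and t: "\<And>j. 1 \<le> j \<Longrightarrow> j < i \<Longrightarrow> t j = t' j"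
  shows "val_access part i (cov (hard_weight t)) = val_access part i (cov (hard_weight t'))"
proof
  fix T
  show "val_access part i (cov (hard_weight t)) T = val_access part i (cov (hard_weight t')) T"
  proof (cases "T \<subseteq> (\<Union>j\<in>{1..i}. part j)")
    case True
    have "(\<Union>j\<in>{1..i}. part j) = elem N ` {e. e < N \<and> cls e \<le> i}"
      using cls_bounds(1) unfolding part_def by fastforce
    with True have "T \<subseteq> elem N ` {e. e < N \<and> cls e \<le> i}" by (simp only:)
    then obtain S where S: "S \<subseteq> {e. e < N \<and> cls e \<le> i}" "T = elem N ` S"
      by (rule subset_imageE)
    have "S \<subseteq> {..<N}" "finite S" using S by (auto intro: finite_subset[of _ "{..<N}"])
    moreover have "hard_value t S = hard_value t' S"
      using \<open>finite S\<close> S t by (intro hard_value_cong[OF i]) auto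
    ultimately show ?thesis using S by (simp add: val_access_def cov_hard_weight)
  qed (simp add: val_access_def)
qed

lemma offered_subset: "i \<in> {1..p} \<Longrightarrow> offered x i \<subseteq> part i"
  unfolding offered_def part_def using slot_less cls_slot by (intro image_mono) auto

lemma cov_input_hard: "cov_input p part (offered x) (hard_weight t)"
  unfolding cov_input_def using offered_subset hard_weight_nonneg by simp

text \<open>Slots are distinct elements, so an output of offered elements that contains a slot
  certifies the bit of its pair.\<close>

lemma elem_slot_in_offered_iff:
  assumes "i \<in> {1..p}" "j < s"
  shows "elem N (slot i j b) \<in> (\<Union>k\<in>{1..p}. offered x k) \<longleftrightarrow> x i j = b"
proof
  assume "elem N (slot i j b) \<in> (\<Union>k\<in>{1..p}. offered x k)"
  then obtain k j' where k: "k \<in> {1..p}" "j' < s"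
    "elem N (slot i j b) = elem N (slot k j' (x k j'))"
    by (auto simp: offered_def)
  hence eq: "slot i j b = slot k j' (x k j')"
    using assms slot_less by (intro inj_onD[OF inj_on_elem[of N]]) auto
  hence "i = k" using k assms cls_slot by (metis atLeastAtMost_iff)
  thus "x i j = b" using eq slot_inject by blast
next
  assume "x i j = b"
  thus "elem N (slot i j b) \<in> (\<Union>k\<in>{1..p}. offered x k)"
    using assms unfolding offered_def by (intro UN_I[of i]) auto
qed

lemma is_partition_part: "is_partition (elem N ` {..<N}) p part"
proof -
  have "disjoint_family_on part {1..p}"
    unfolding disjoint_family_on_def part_def by (auto dest!: inj_onD[OF inj_on_elem])
  moreover have "(\<Union>i\<in>{1..p}. part i) = elem N ` {..<N}"
    unfolding part_def using cls_bounds by fastforce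
  ultimately show ?thesis by (simp add: is_partition_def)
qed

section \<open>Hits on specials, averaged over the family\<close>

abbreviation (input) oracles :: "(nat \<Rightarrow> nat) \<Rightarrow> nat \<Rightarrow> nat set set \<Rightarrow> real" where
  "oracles t \<equiv> \<lambda>i. val_access part i (cov (hard_weight t))"

text \<open>An instance \<open>z\<close> gives, per class, the owned member of every pair and the
  index of the pair that carries the special.\<close>

definition bits_of :: "(nat \<Rightarrow> (nat \<Rightarrow> bool) \<times> nat) \<Rightarrow> nat \<Rightarrow> nat \<Rightarrow> bool" where
  "bits_of z i = fst (z i)"

definition special_of :: "(nat \<Rightarrow> (nat \<Rightarrow> bool) \<times> nat) \<Rightarrow> nat \<Rightarrow> nat" where
  "special_of z i = slot i (snd (z i)) (fst (z i) (snd (z i)))"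

text \<open>All specials are offered, so the optimum is at least one. An output without specials of
  classes below \<open>p\<close> is worth at most \<open>\<rho>\<close>, any other at most one;
  hence the expected value is at most \<open>\<rho>\<close> plus the expected number of such
  specials. The gain \<open>\<rho> * \<epsilon>\<close> is at least \<open>\<epsilon> / 2\<close>
  because \<open>\<rho> >= 1/2\<close>.\<close>

lemma expected_hits_ge:
  assumes G: "cov_protocol_guarantee p p part (\<rho> * (1 + \<epsilon>)) A Out"
    and \<rho>: "\<rho> = (real p + (harm p)\<^sup>2) / (2 * real p - harm p)" and \<epsilon>: "0 < \<epsilon>"
    and j: "\<And>i. i \<in> {1..p} \<Longrightarrow> j i < s"
    and t: "\<And>i. i \<in> {1..p} \<Longrightarrow> t i = slot i (j i) (x i (j i))"
  shows "\<epsilon> / 2 \<le> (\<Sum>i\<in>{1..<p}.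
    measure (measure_pmf (prot_output A Out p (offered x) (oracles t))) {T. elem N (t i) \<in> T})"
proof -
  define D where "D = prot_output A Out p (offered x) (oracles t)"
  define VV where "VV = (\<Union>i\<in>{1..p}. offered x i)"
  define F where "F = cov (hard_weight t)"
  have "finite VV" by (auto simp: VV_def offered_def)
  have VVs: "VV \<subseteq> elem N ` {..<N}"
    using offered_subset unfolding VV_def part_def by fastforce
  have out: "\<And>T. T \<in> set_pmf D \<Longrightarrow> T \<subseteq> VV \<and> card T \<le> p"
    and val: "\<rho> * (1 + \<epsilon>) * Max {F T | T. T \<subseteq> VV \<and> card T \<le> p} \<le> measure_pmf.expectation D F"
    using G cov_input_hard[of x t]
    unfolding cov_protocol_guarantee_def Let_def D_def VV_def F_def by blast+
  have half: "1 / 2 \<le> \<rho>"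
  proof -
    have "0 < 2 * real p - harm p" using harm_le_self[of p] p by simp
    thus ?thesis unfolding \<rho> using harm_nonneg[of p, where 'a = real] by (simp add: field_simps)
  qed
  have cls_t: "cls (t i) = i" and t_less: "t i < N" if "i \<in> {1..p}" for i
    using that t j slot_less cls_slot by auto
  have "1 = F (elem N ` t ` {1..p})"
  proof -
    have "t ` {1..p} \<subseteq> {..<N}" using t_less by auto
    hence "F (elem N ` t ` {1..p}) = hard_value t (t ` {1..p})"
      unfolding F_def by (rule cov_hard_weight)
    also have "\<dots> = 1" by (intro hard_value_specials cls_t)
    finally show ?thesis by simp
  qed
  also have "\<dots> \<le> Max {F T | T. T \<subseteq> VV \<and> card T \<le> p}"
  proof (rule Max_ge)
    have "{F T | T. T \<subseteq> VV \<and> card T \<le> p} \<subseteq> F ` Pow VV" by auto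
    thus "finite {F T | T. T \<subseteq> VV \<and> card T \<le> p}"
      using \<open>finite VV\<close> by (meson finite_Pow_iff finite_imageI finite_subset)
    have "elem N ` t ` {1..p} \<subseteq> VV"
      unfolding VV_def using t j elem_slot_in_offered_iff by auto
    moreover have "card (elem N ` t ` {1..p}) \<le> p"
      using card_image_le[of "{1..p}" "elem N \<circ> t"] by (simp add: image_comp)
    ultimately show "F (elem N ` t ` {1..p}) \<in> {F T | T. T \<subseteq> VV \<and> card T \<le> p}" by blast
  qed
  finally have "\<rho> * (1 + \<epsilon>) * 1 \<le> \<rho> * (1 + \<epsilon>) * Max {F T | T. T \<subseteq> VV \<and> card T \<le> p}"
    using half \<epsilon> by (intro mult_left_mono) auto
  also note val
  finally have low: "\<rho> * (1 + \<epsilon>) \<le> measure_pmf.expectation D F" by (simp only: mult_1_right)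
  have "finite (set_pmf D)"
    by (rule finite_subset[of _ "Pow VV"]) (use out \<open>finite VV\<close> in \<open>simp_all add: subset_iff\<close>)
  hence int: "integrable (measure_pmf D) h" for h :: "nat set set \<Rightarrow> real"
    by (rule integrable_measure_pmf_finite)
  have up: "F T \<le> \<rho> + (\<Sum>i\<in>{1..<p}. indicator {T. elem N (t i) \<in> T} T)" if T: "T \<in> set_pmf D" for T
  proof -
    obtain S where S: "S \<subseteq> {..<N}" "T = elem N ` S"
      using out[OF T] VVs by (meson order_trans subset_image_iff)
    have "card S \<le> p"
      using out[OF T] S card_image[OF inj_on_subset[OF inj_on_elem S(1)]] by simp
    have fin: "finite S" using S finite_subset by blast
    have F: "F T = hard_value t S" using S by (simp add: F_def cov_hard_weight)
    show ?thesis
    proof (cases "\<exists>i\<in>{1..<p}. t i \<in> S")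
      case True
      then obtain i where i: "i \<in> {1..<p}" "t i \<in> S" by blast
      have "F T \<le> 1" unfolding F by (rule hard_value_le_1)
      also have "1 = (indicator {T. elem N (t i) \<in> T} T :: real)" using i S by simp
      also have "\<dots> \<le> (\<Sum>i\<in>{1..<p}. indicator {T. elem N (t i) \<in> T} T)"
        using i by (intro member_le_sum) auto
      finally show ?thesis using half by simp
    next
      case False
      hence "F T \<le> \<rho>"
        unfolding F \<rho> using fin \<open>card S \<le> p\<close> by (intro hard_value_no_special) auto
      thus ?thesis by (simp add: add_increasing2 sum_nonneg)
    qed
  qed
  have "measure_pmf.expectation D F
      \<le> measure_pmf.expectation D (\<lambda>T. \<rho> + (\<Sum>i\<in>{1..<p}. indicator {T. elem N (t i) \<in> T} T))"
    using up by (intro integral_mono_AE int) (simp add: AE_measure_pmf_iff)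
  also have "\<dots> = \<rho> + (\<Sum>i\<in>{1..<p}. measure (measure_pmf D) {T. elem N (t i) \<in> T})"
    by (simp add: int)
  finally have "\<rho> * \<epsilon> \<le> (\<Sum>i\<in>{1..<p}. measure (measure_pmf D) {T. elem N (t i) \<in> T})"
    using low by (simp add: algebra_simps)
  moreover have "1 / 2 * \<epsilon> \<le> \<rho> * \<epsilon>" using half \<epsilon> by (intro mult_right_mono) auto
  ultimately show ?thesis by (simp add: D_def)
qed

text \<open>Outside class \<open>i\<close> everything is fixed. The message of player
  \<open>i\<close> depends on \<open>X\<close> but not on \<open>j\<close>, since the oracles up to
  \<open>i\<close> hide the special; later players see \<open>X\<close> only through the message and
  the special. Outputs consist of offered elements, so a hit is a certain guess of
  \<open>X j\<close> and \<open>certain_guesses_le\<close> applies.\<close>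

lemma sum_hits_le:
  assumes out: "\<And>x t T. T \<in> set_pmf (prot_output A Out p (offered x) (oracles t)) \<Longrightarrow>
      T \<subseteq> (\<Union>k\<in>{1..p}. offered x k)"
    and len: "\<And>x t m. m \<in> set_pmf (msgs A (offered x) (oracles t) i) \<Longrightarrow> length m \<le> L"
    and i: "i \<in> {1..<p}"
  shows "(\<Sum>X\<in>{..<s} \<rightarrow>\<^sub>E UNIV. \<Sum>j<s.
      measure (measure_pmf (prot_output A Out p (offered (x(i := X))) (oracles (t(i := slot i j (X j))))))
        {T. elem N (slot i j (X j)) \<in> T})
    \<le> (real L + 2) * 2 ^ s"
proof -
  define M where "M X = msgs A (offered (x(i := X))) (oracles t) i" for X
  \<comment> \<open>The bit of the special is a free argument \<open>b\<close>, so that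
    \<open>R\<close> does not mention \<open>X\<close>.\<close>
  define R where "R m j b = output_from A Out p (offered x) (oracles (t(i := slot i j b))) i m" for m j b
  define g where "g m j b = measure (measure_pmf (R m j b)) {T. elem N (slot i j b) \<in> T}" for m j b
  have split: "prot_output A Out p (offered (x(i := X))) (oracles (t(i := slot i j b)))
      = bind_pmf (M X) (\<lambda>m. R m j b)" for X j b
  proof -
    have "oracles (t(i := slot i j b)) k = oracles t k" if "1 \<le> k" "k \<le> i" for k
      using that i by (intro val_access_cong) auto
    hence "msgs A (offered (x(i := X))) (oracles (t(i := slot i j b))) i = M X"
      unfolding M_def by (intro msgs_cong) auto
    moreover have "output_from A Out p (offered (x(i := X))) (oracles (t(i := slot i j b))) i m = R m j b" for m
      unfolding R_def using i by (intro output_from_cong) (auto simp: offered_def)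
    ultimately show ?thesis
      using i prot_output_split[of i p A Out "offered (x(i := X))" "oracles (t(i := slot i j b))"]
      by (auto intro: bind_pmf_cong)
  qed
  have M_len: "set_pmf (M X) \<subseteq> {m. length m \<le> L}" for X
    using len unfolding M_def by blast
  have "X j = b" if m: "m \<in> set_pmf (M X)" and "j < s" and pos: "g m j b > 0" for X m j b
  proof -
    have "{T. elem N (slot i j b) \<in> T} \<inter> set_pmf (R m j b) \<noteq> {}"
      using pos unfolding g_def by (metis measure_Int_set_pmf measure_empty less_irrefl)
    then obtain T where T: "T \<in> set_pmf (R m j b)" "elem N (slot i j b) \<in> T" by blast
    have "T \<in> set_pmf (prot_output A Out p (offered (x(i := X))) (oracles (t(i := slot i j b))))"
      unfolding split using m T by auto
    hence "elem N (slot i j b) \<in> (\<Union>k\<in>{1..p}. offered (x(i := X)) k)"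
      using out T(2) by blast
    thus ?thesis using elem_slot_in_offered_iff[of i j b "x(i := X)"] i \<open>j < s\<close> by simp
  qed
  moreover have "g m j b \<le> 1" for m j b unfolding g_def by simp
  ultimately have "(\<Sum>X\<in>{..<s} \<rightarrow>\<^sub>E UNIV. \<Sum>j<s. \<Sum>m | length m \<le> L. g m j (X j) * pmf (M X) m)
      \<le> (real L + 2) * 2 ^ s"
    using M_len by (intro certain_guesses_le) auto
  moreover have "measure (measure_pmf (prot_output A Out p (offered (x(i := X))) (oracles (t(i := slot i j (X j))))))
        {T. elem N (slot i j (X j)) \<in> T} = (\<Sum>m | length m \<le> L. g m j (X j) * pmf (M X) m)" for X j
    unfolding split g_def by (rule measure_bind_pmf_finite[OF finite_bool_lists_length_le M_len])
  ultimately show ?thesis by simp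
qed

text \<open>Double counting over all instances: each has hits of at least
  \<open>\<epsilon> / 2\<close>, while for each class \<open>i\<close> and each fixing of the other
  classes the hits sum to at most \<open>(L + 2) * 2 ^ s\<close>. Dividing by
  \<open>card B ^ (p - 1)\<close> and \<open>2 ^ s\<close> leaves the factor \<open>s\<close>, the
  number of positions of the special.\<close>

lemma message_length_bound:
  assumes G: "cov_protocol_guarantee p p part
      ((real p + (harm p)\<^sup>2) / (2 * real p - harm p) * (1 + \<epsilon>)) A Out"
    and \<epsilon>: "0 < \<epsilon>" and L: "\<And>n. n \<in> cov_msg_lengths p part A \<Longrightarrow> n \<le> L"
  shows "\<epsilon> / 2 * real s \<le> real (p - 1) * (real L + 2)"
proof -
  define B where "B = ({..<s} \<rightarrow>\<^sub>E (UNIV :: bool set)) \<times> {..<s}"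
  define Z where "Z = {1..p} \<rightarrow>\<^sub>E B"
  define hit where "hit i z = measure (measure_pmf (prot_output A Out p (offered (bits_of z)) (oracles (special_of z))))
    {T. elem N (special_of z i) \<in> T}" for i z
  have B: "card B = 2 ^ s * s"
    by (simp add: B_def card_cartesian_product card_funcsetE)
  have cardB0: "0 < card B" using s by (simp add: B)
  have cardZ: "card Z = card B ^ p" by (simp add: Z_def card_funcsetE)
  have low: "\<epsilon> / 2 \<le> (\<Sum>i\<in>{1..<p}. hit i z)" if z: "z \<in> Z" for z
    unfolding hit_def
  proof (rule expected_hits_ge[OF G refl \<epsilon>, of "\<lambda>i. snd (z i)"])
    fix i assume i: "i \<in> {1..p}"
    have "z i \<in> B" using z i unfolding Z_def by (rule PiE_mem)
    thus "snd (z i) < s" by (simp add: B_def mem_Times_iff)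
    show "special_of z i = slot i (snd (z i)) (bits_of z i (snd (z i)))"
      by (simp add: special_of_def bits_of_def)
  qed
  have up: "(\<Sum>z\<in>Z. hit i z) \<le> real (card B ^ (p - 1)) * ((real L + 2) * 2 ^ s)"
    if i: "i \<in> {1..<p}" for i
  proof -
    have fibre: "(\<Sum>y\<in>B. hit i (g(i := y))) \<le> (real L + 2) * 2 ^ s" for g
    proof -
      have "(\<Sum>y\<in>B. hit i (g(i := y))) = (\<Sum>X\<in>{..<s} \<rightarrow>\<^sub>E UNIV. \<Sum>j<s. hit i (g(i := (X, j))))"
        by (simp add: B_def sum.cartesian_product)
      also have "\<dots> = (\<Sum>X\<in>{..<s} \<rightarrow>\<^sub>E UNIV. \<Sum>j<s.
        measure (measure_pmf (prot_output A Out p (offered ((bits_of g)(i := X)))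
            (oracles ((special_of g)(i := slot i j (X j))))))
          {T. elem N (slot i j (X j)) \<in> T})"
      proof (intro sum.cong refl)
        fix X j
        have "bits_of (g(i := (X, j))) = (bits_of g)(i := X)"
          and "special_of (g(i := (X, j))) = (special_of g)(i := slot i j (X j))"
          by (auto simp: bits_of_def special_of_def)
        thus "hit i (g(i := (X, j))) = measure (measure_pmf (prot_output A Out p (offered ((bits_of g)(i := X)))
            (oracles ((special_of g)(i := slot i j (X j))))))
          {T. elem N (slot i j (X j)) \<in> T}"
          by (simp add: hit_def)
      qed
      also have "\<dots> \<le> (real L + 2) * 2 ^ s"
      proof (rule sum_hits_le[OF _ _ i])
        fix x t T assume "T \<in> set_pmf (prot_output A Out p (offered x) (oracles t))"
        thus "T \<subseteq> (\<Union>k\<in>{1..p}. offered x k)"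
          using G cov_input_hard[of x t] unfolding cov_protocol_guarantee_def Let_def by blast
      next
        fix x t m assume "m \<in> set_pmf (msgs A (offered x) (oracles t) i)"
        hence "length m \<in> cov_msg_lengths p part A"
          using i cov_input_hard[of x t] unfolding cov_msg_lengths_def by fastforce
        thus "length m \<le> L" by (rule L)
      qed
      finally show ?thesis .
    qed
    have "(\<Sum>z\<in>Z. hit i z) = (\<Sum>g\<in>({1..p} - {i}) \<rightarrow>\<^sub>E B. \<Sum>y\<in>B. hit i (g(i := y)))"
      unfolding Z_def using i by (intro sum_PiE_remove) simp
    also have "\<dots> \<le> (\<Sum>g\<in>({1..p} - {i}) \<rightarrow>\<^sub>E B. (real L + 2) * 2 ^ s)"
      by (intro sum_mono fibre)
    also have "\<dots> = real (card B ^ (p - 1)) * ((real L + 2) * 2 ^ s)"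
      using i by (simp add: card_funcsetE)
    finally show ?thesis .
  qed
  have "real (card B ^ p) * (\<epsilon> / 2) = (\<Sum>z\<in>Z. \<epsilon> / 2)" by (simp add: cardZ)
  also have "\<dots> \<le> (\<Sum>z\<in>Z. \<Sum>i\<in>{1..<p}. hit i z)" by (intro sum_mono low)
  also have "\<dots> = (\<Sum>i\<in>{1..<p}. \<Sum>z\<in>Z. hit i z)" by (rule sum.swap)
  also have "\<dots> \<le> (\<Sum>i\<in>{1..<p}. real (card B ^ (p - 1)) * ((real L + 2) * 2 ^ s))"
    by (intro sum_mono up)
  also have "\<dots> = real (card B ^ (p - 1)) * (real (p - 1) * ((real L + 2) * 2 ^ s))" by simp
  also have "real (card B ^ p) * (\<epsilon> / 2) = real (card B ^ (p - 1)) * (real (card B) * (\<epsilon> / 2))"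
    using p by (cases p) auto
  finally have "real (card B) * (\<epsilon> / 2) \<le> real (p - 1) * ((real L + 2) * 2 ^ s)"
    using cardB0 by (simp add: mult_le_cancel_left_pos)
  hence "2 ^ s * (\<epsilon> / 2 * real s) \<le> 2 ^ s * (real (p - 1) * (real L + 2))"
    by (simp add: B mult_ac)
  thus ?thesis by (rule mult_left_le_imp_le) simp
qed

end

section \<open>Choice of parameters\<close>

theorem theorem3:
  shows "\<exists>c::real > 0. \<forall>\<epsilon>::real > 0. \<forall>p::nat \<ge> 2. \<exists>N0::nat. \<forall>N \<ge> N0.
     \<exists>(W :: nat set set) (Wp :: nat \<Rightarrow> nat set set).
        finite W \<and> card W = N \<and> (\<forall>v\<in>W. finite v) \<and> is_partition W p Wp \<and>
        (\<forall>A Out. cov_protocol_guarantee p p Wp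
                   ((real p + harm p ^ 2) / (2 * real p - harm p) * (1 + \<epsilon>)) A Out
           \<longrightarrow> (\<exists>n\<in>cov_msg_lengths p Wp A. real n \<ge> c * real N * \<epsilon> / real p ^ 3))"
proof (intro exI[of _ "1 / 8 :: real"] conjI allI impI)
  fix \<epsilon> :: real and p :: nat
  assume \<epsilon>: "0 < \<epsilon>" and p: "2 \<le> p"
  show "\<exists>N0::nat. \<forall>N \<ge> N0.
     \<exists>(W :: nat set set) (Wp :: nat \<Rightarrow> nat set set).
        finite W \<and> card W = N \<and> (\<forall>v\<in>W. finite v) \<and> is_partition W p Wp \<and>
        (\<forall>A Out. cov_protocol_guarantee p p Wp
                   ((real p + harm p ^ 2) / (2 * real p - harm p) * (1 + \<epsilon>)) A Out
           \<longrightarrow> (\<exists>n\<in>cov_msg_lengths p Wp A. real n \<ge> 1 / 8 * real N * \<epsilon> / real p ^ 3))"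
  \<comment> \<open>The term \<open>4 p\<close> ensures \<open>s >= 1\<close>. The whole threshold,
    times \<open>\<epsilon> / (8 p)\<close>, equals \<open>\<epsilon> / 2 + 2 p\<close>, the loss
    from rounding \<open>s\<close> down and from the \<open>2\<close> in
    \<open>L + 2\<close>.\<close>
  proof (intro exI[of _ "nat \<lceil>4 * real p + 16 * (real p)\<^sup>2 / \<epsilon>\<rceil>"] allI impI)
    fix N assume "nat \<lceil>4 * real p + 16 * (real p)\<^sup>2 / \<epsilon>\<rceil> \<le> N"
    hence N0: "4 * real p + 16 * (real p)\<^sup>2 / \<epsilon> \<le> real N" by linarith
    define s where "s = N div (2 * p)"
    have p0: "real p > 0" using p by simp
    have "2 * p \<le> N"
    proof -
      have "0 \<le> 16 * (real p)\<^sup>2 / \<epsilon>" using \<epsilon> by simp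
      hence "real (2 * p) \<le> real N" using N0 p0 by simp
      thus ?thesis by (simp only: of_nat_le_iff)
    qed
    hence s1: "1 \<le> s" using p by (simp add: s_def div_greater_zero_iff Suc_le_eq)
    have sN: "2 * p * s \<le> N" by (simp add: s_def)
    interpret hard_family p s N by unfold_locales (fact p s1 sN)+
    have s_ge: "real N / (2 * real p) - 1 \<le> real s"
    proof -
      have "N < 2 * p * s + 2 * p"
        using p mod_less_divisor[of "2 * p" N] mult_div_mod_eq[of "2 * p" N] unfolding s_def by linarith
      hence "real N \<le> 2 * real p * real s + 2 * real p"
        by (metis less_imp_le of_nat_add of_nat_le_iff of_nat_mult of_nat_numeral)
      thus ?thesis using p0 by (simp add: field_simps)
    qed
    show "\<exists>(W :: nat set set) (Wp :: nat \<Rightarrow> nat set set).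
        finite W \<and> card W = N \<and> (\<forall>v\<in>W. finite v) \<and> is_partition W p Wp \<and>
        (\<forall>A Out. cov_protocol_guarantee p p Wp
                   ((real p + harm p ^ 2) / (2 * real p - harm p) * (1 + \<epsilon>)) A Out
           \<longrightarrow> (\<exists>n\<in>cov_msg_lengths p Wp A. real n \<ge> 1 / 8 * real N * \<epsilon> / real p ^ 3))"
    proof (intro exI[of _ "elem N ` {..<N}"] exI[of _ part] conjI allI impI)
      show "card (elem N ` {..<N}) = N" by (simp add: card_image inj_on_elem)
      show "\<forall>v\<in>elem N ` {..<N}. finite v" by (simp add: finite_elem)
      show "is_partition (elem N ` {..<N}) p part" by (rule is_partition_part)
      fix A Out
      assume G: "cov_protocol_guarantee p p part
        ((real p + harm p ^ 2) / (2 * real p - harm p) * (1 + \<epsilon>)) A Out"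
      define \<beta> where "\<beta> = 1 / 8 * real N * \<epsilon> / real p ^ 3"
      have \<beta>0: "0 \<le> \<beta>" using \<epsilon> by (simp add: \<beta>_def)
      show "\<exists>n\<in>cov_msg_lengths p part A. \<beta> \<le> real n"
      \<comment> \<open>If every length is below \<open>\<beta>\<close>, its floor is a valid bound
        \<open>L\<close>.\<close>
      proof (rule ccontr)
        assume "\<not> (\<exists>n\<in>cov_msg_lengths p part A. \<beta> \<le> real n)"
        hence "n \<le> nat \<lfloor>\<beta>\<rfloor>" if "n \<in> cov_msg_lengths p part A" for n
          using that by (intro le_nat_floor) (auto simp: not_le)
        hence "\<epsilon> / 2 * real s \<le> real (p - 1) * (real (nat \<lfloor>\<beta>\<rfloor>) + 2)"
          by (rule message_length_bound[OF G \<epsilon>])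
        also have "\<dots> \<le> (real p - 1) * (\<beta> + 2)"
          using \<beta>0 p by (intro mult_mono) auto
        also have "\<dots> < real p * (\<beta> + 2)" using \<beta>0 by simp
        finally have "\<epsilon> / 2 * (real N / (2 * real p) - 1) < real p * (\<beta> + 2)"
          using mult_left_mono[OF s_ge, of "\<epsilon> / 2"] \<epsilon> by linarith
        moreover have "real p * \<beta> \<le> \<epsilon> * real N / (8 * real p)"
        proof -
          \<comment> \<open>Of the three factors \<open>1/p\<close> in \<open>\<beta>\<close>, one
            cancels and another is given away here.\<close>
          have "real p * \<beta> = \<epsilon> * real N / (8 * real p) * (1 / real p)"
            using p0 by (simp add: \<beta>_def power3_eq_cube mult_ac)
          also have "\<dots> \<le> \<epsilon> * real N / (8 * real p) * 1"
            using \<epsilon> p by (intro mult_left_mono) auto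
          finally show ?thesis by simp
        qed
        ultimately have "\<epsilon> * real N / (8 * real p) < \<epsilon> / 2 + 2 * real p"
          by (simp add: field_simps)
        moreover have "\<epsilon> / 2 + 2 * real p = \<epsilon> / (8 * real p) * (4 * real p + 16 * (real p)\<^sup>2 / \<epsilon>)"
          using \<epsilon> p0 by (simp add: field_simps power2_eq_square)
        moreover have "\<dots> \<le> \<epsilon> / (8 * real p) * real N"
          using N0 \<epsilon> by (intro mult_left_mono) auto
        ultimately show False by simp
      qed
    qed simp
  qed
qed simp

end
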